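(* The Fermat cubic threefold $F_4=\{x_0^3+x_1^3+x_2^3+x_3^3+x_4^3=0\}\subset\mathbb{P}^4$ over $\mathbb{C}$ contains exactly $135$ triple lines.
   Context: Let $X\subset\mathbb{P}^4$ be a smooth complex cubic threefold. A line $\ell\subset X$ is of the second type if there exists a unique 2-plane $P\simeq\mathbb{P}^2$ containing $\ell$ such that $P\cap X=2\ell\cup\ell'$ as plane cubic curves (divisors in $P$), for some line $\ell'\subset P$, where $\ell'=\ell$ is allowed. A line $\ell\subset X$ of the second type is called a triple line if this plane satisfies $P\cap X=3\ell$ (that is, $\ell'=\ell$). *)

theory Defs
  imports "HOL-Analysis.Analysis"
begin

text \<open>
  A linear subspace of projective dimension \<open>n\<close> in \<open>\<P>\<^sup>4\<close> is represented by its affine cone,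
  a complex vector subspace of dimension \<open>n + 1\<close> of \<open>\<complex>\<^sup>5\<close>. The constants \<open>vec.subspace\<close> and
  \<open>vec.dim\<close> refer to the complex scalar multiplication, whereas the unqualified \<open>subspace\<close> and
  \<open>dim\<close> would refer to the real structure.
\<close>

definition proj_subspace :: "nat \<Rightarrow> (complex^5) set \<Rightarrow> bool" where
  "proj_subspace n W \<longleftrightarrow> vec.subspace W \<and> vec.dim W = n + 1"

abbreviation proj_line :: "(complex^5) set \<Rightarrow> bool" where
  "proj_line \<equiv> proj_subspace 1"

abbreviation proj_plane :: "(complex^5) set \<Rightarrow> bool" where
  "proj_plane \<equiv> proj_subspace 2"

text \<open>
  Forms are represented by the functions they induce on \<open>\<complex>\<^sup>5\<close>; this loses nothing as the field is
  infinite. The hypersurface \<open>F = 0\<close> is smooth when no nonzero vector is a zero of \<open>F\<close> and of all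
  its partial derivatives.
\<close>

definition cubic_form :: "(complex^5 \<Rightarrow> complex) \<Rightarrow> bool" where
  "cubic_form F \<longleftrightarrow>
     (\<exists>c :: 5 \<Rightarrow> 5 \<Rightarrow> 5 \<Rightarrow> complex.
        \<forall>v. F v = (\<Sum>i\<in>UNIV. \<Sum>j\<in>UNIV. \<Sum>k\<in>UNIV. c i j k * v $ i * v $ j * v $ k))"

definition smooth_cubic_threefold :: "(complex^5 \<Rightarrow> complex) \<Rightarrow> bool" where
  "smooth_cubic_threefold F \<longleftrightarrow> cubic_form F \<and>
     (\<forall>v. v \<noteq> 0 \<and> F v = 0 \<longrightarrow> (\<exists>i. deriv (\<lambda>t. F (v + t *s axis i 1)) 0 \<noteq> 0))"

abbreviation linear_form :: "(complex^5 \<Rightarrow> complex) \<Rightarrow> bool" where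
  "linear_form \<equiv> Vector_Spaces.linear (*s) (*)"

text \<open>
  \<open>section_eq F P l l'\<close> says that \<open>P \<inter> {F = 0} = 2l + l'\<close> as divisors in the plane \<open>P\<close>. Two nonzero
  cubic forms on \<open>P\<close> define the same divisor iff they are proportional, and every linear form on
  \<open>P\<close> is the restriction of one on \<open>\<complex>\<^sup>5\<close>.
\<close>

definition section_eq ::
  "(complex^5 \<Rightarrow> complex) \<Rightarrow> (complex^5) set \<Rightarrow> (complex^5) set \<Rightarrow> (complex^5) set \<Rightarrow> bool" where
  "section_eq F P l l' \<longleftrightarrow>
     (\<exists>a b. linear_form a \<and> linear_form b \<and>
        l = {v \<in> P. a v = 0} \<and> l' = {v \<in> P. b v = 0} \<and>
        (\<exists>c. c \<noteq> 0 \<and> (\<forall>v\<in>P. F v = c * ((a v)\<^sup>2 * b v))))"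

definition line_on :: "(complex^5 \<Rightarrow> complex) \<Rightarrow> (complex^5) set \<Rightarrow> bool" where
  "line_on F l \<longleftrightarrow> proj_line l \<and> (\<forall>v\<in>l. F v = 0)"

definition second_type :: "(complex^5 \<Rightarrow> complex) \<Rightarrow> (complex^5) set \<Rightarrow> bool" where
  "second_type F l \<longleftrightarrow> line_on F l \<and>
     (\<exists>!P. proj_plane P \<and> l \<subseteq> P \<and> (\<exists>l'. proj_line l' \<and> l' \<subseteq> P \<and> section_eq F P l l'))"

text \<open>By uniqueness, the plane \<open>P\<close> below is the one in the definition of \<open>second_type\<close>.\<close>

definition triple_line :: "(complex^5 \<Rightarrow> complex) \<Rightarrow> (complex^5) set \<Rightarrow> bool" where
  "triple_line F l \<longleftrightarrow> second_type F l \<and> (\<exists>P. proj_plane P \<and> l \<subseteq> P \<and> section_eq F P l l)"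

definition fermat_cubic :: "complex^5 \<Rightarrow> complex" where
  "fermat_cubic x = (\<Sum>i\<in>UNIV. (x $ i) ^ 3)"

lemma smooth_fermat_cubic: "smooth_cubic_threefold fermat_cubic"
  unfolding smooth_cubic_threefold_def
proof (intro conjI allI impI)
  show "cubic_form fermat_cubic"
    unfolding cubic_form_def
  proof (intro exI allI)
    fix v :: "complex^5"
    have "(\<Sum>j\<in>UNIV. \<Sum>k\<in>UNIV. (if i = j \<and> j = k then 1 else 0) * v $ i * v $ j * v $ k) = (v $ i) ^ 3"
      for i :: 5
    proof -
      have "(\<Sum>k\<in>UNIV. (if i = j \<and> j = k then 1 else 0) * v $ i * v $ j * v $ k)
          = (if i = j then (v $ i) ^ 3 else 0)" for j :: 5
      proof (cases "i = j")
        case True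
        have "(\<Sum>k\<in>UNIV. (if i = j \<and> j = k then 1 else 0) * v $ i * v $ j * v $ k)
            = (\<Sum>k\<in>UNIV. if i = k then v $ i * v $ i * v $ k else 0)"
          by (rule sum.cong) (auto simp: True)
        also have "\<dots> = v $ i * v $ i * v $ i"
          by (simp only: sum.delta' finite_class.finite_UNIV UNIV_I if_True)
        finally show ?thesis
          by (simp add: True power3_eq_cube)
      qed simp
      then show ?thesis
        by simp
    qed
    then show "fermat_cubic v = (\<Sum>i\<in>UNIV. \<Sum>j\<in>UNIV. \<Sum>k\<in>UNIV.
        (if i = j \<and> j = k then 1 else 0) * v $ i * v $ j * v $ k)"
      by (simp add: fermat_cubic_def)
  qed
next
  fix v :: "complex^5"
  assume "v \<noteq> 0 \<and> fermat_cubic v = 0"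
  then obtain i where i: "v $ i \<noteq> 0"
    by (auto simp: vec_eq_iff)
  have "((\<lambda>t. \<Sum>j\<in>UNIV. (v $ j + t * axis i 1 $ j) ^ 3) has_field_derivative
      (\<Sum>j\<in>UNIV. 3 * (v $ j)\<^sup>2 * axis i 1 $ j)) (at 0)"
    by (rule DERIV_sum) (auto intro!: derivative_eq_intros)
  moreover have "(\<Sum>j\<in>UNIV. 3 * (v $ j)\<^sup>2 * axis i 1 $ j) = 3 * (v $ i)\<^sup>2"
    by (simp add: axis_def if_distrib cong: if_cong)
  ultimately have "deriv (\<lambda>t. fermat_cubic (v + t *s axis i 1)) 0 = 3 * (v $ i)\<^sup>2"
    by (simp add: fermat_cubic_def DERIV_imp_deriv)
  then show "\<exists>i. deriv (\<lambda>t. fermat_cubic (v + t *s axis i 1)) 0 \<noteq> 0"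
    using i by (intro exI[of _ i]) simp
qed

end

theory Submission
  imports Defs
begin

text \<open>
  Let \<open>l\<close> be a triple line with plane \<open>P\<close>, so that \<open>fermat_cubic = c * a\<^sup>3\<close> on \<open>P\<close> with
  \<open>l = {a = 0}\<close>. Expanding along \<open>l\<close> shows that the trilinear form
  \<open>polar u v w = (\<Sum>i. u\<^sub>i v\<^sub>i w\<^sub>i)\<close> satisfies \<open>polar v v' w = 0\<close> for \<open>v, v' \<in> l\<close> and \<open>w \<in> P\<close>. In other
  words, the coordinatewise products \<open>p\<^sup>2\<close>, \<open>pq\<close>, \<open>q\<^sup>2\<close> of a basis of \<open>l\<close> lie in the annihilator of
  \<open>P\<close> for the pairing \<open>\<Sum>i. x\<^sub>i y\<^sub>i\<close>. That annihilator has dimension two, so the three products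
  are linearly dependent. The relation is a binary quadratic form vanishing at all points
  \<open>(p\<^sub>i, q\<^sub>i)\<close>; its two linear factors give two vectors of \<open>l\<close> whose coordinatewise product is zero.
  Hence \<open>l\<close> is spanned by vectors \<open>p\<close>, \<open>q\<close> with disjoint supports
  (\<open>triple_section_disjoint_basis\<close>).

  A zero of \<open>fermat_cubic\<close> has at least two nonzero coordinates, and a support of three coordinates
  is excluded by testing against a vector of \<open>P\<close> outside \<open>l\<close> (\<open>card_support_le_2\<close>). So both supports
  are pairs \<open>{i, j}\<close> and \<open>{k, m}\<close>, and \<open>p\<^sub>i\<^sup>3 + p\<^sub>j\<^sup>3 = 0 = q\<^sub>k\<^sup>3 + q\<^sub>m\<^sup>3\<close> says that \<open>l\<close> is given by
  \<open>x\<^sub>j = - \<alpha> x\<^sub>i\<close>, \<open>x\<^sub>m = - \<beta> x\<^sub>k\<close>, \<open>x\<^sub>r = 0\<close> with cube roots of unity \<open>\<alpha>\<close>, \<open>\<beta>\<close>.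

  Conversely, on the plane \<open>x\<^sub>j = - \<alpha> x\<^sub>i\<close>, \<open>x\<^sub>m = - \<beta> x\<^sub>k\<close> the cubic is \<open>x\<^sub>r\<^sup>3\<close>. It is the only plane
  that meets the threefold doubly along \<open>l\<close>, because \<open>polar v v w = 0\<close> for the two spanning vectors
  \<open>v\<close> of \<open>l\<close> already gives its equations (\<open>paired_line_is_triple\<close>).

  There are 15 ways to choose two disjoint pairs from five indices and \<open>3 * 3\<close> choices of
  \<open>(\<alpha>, \<beta>)\<close>. The pairs and the roots can be read off from the vectors of minimal support in \<open>l\<close>, so the
  lines are distinct, and their number is \<open>15 * 9 = 135\<close>.
\<close>

section \<open>The polar form of the Fermat cubic\<close>

definition polar :: "complex^5 \<Rightarrow> complex^5 \<Rightarrow> complex^5 \<Rightarrow> complex" where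
  "polar u v w = (\<Sum>i\<in>UNIV. u $ i * v $ i * w $ i)"

lemma polar_commute: "polar u v w = polar v u w" "polar u v w = polar u w v"
  by (simp_all add: polar_def mult_ac)

lemma polar_add: "polar u v (w + w') = polar u v w + polar u v w'"
  by (simp add: polar_def algebra_simps sum.distrib)

lemma polar_scale: "polar u v (c *s w) = c * polar u v w"
  by (simp add: polar_def sum_distrib_left mult_ac)

lemma fermat_cubic_polar: "fermat_cubic v = polar v v v"
  by (simp add: fermat_cubic_def polar_def power3_eq_cube)

lemma fermat_cubic_add:
  "fermat_cubic (w + v) = fermat_cubic w + 3 * polar v w w + 3 * polar v v w + fermat_cubic v"
  by (simp add: fermat_cubic_def polar_def power3_eq_cube algebra_simps sum.distrib sum_distrib_left)

lemma polar_supported: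
  assumes "\<And>n. n \<notin> A \<Longrightarrow> u $ n = 0"
  shows "polar u v w = (\<Sum>n\<in>A. u $ n * v $ n * w $ n)"
  unfolding polar_def using assms by (intro sum.mono_neutral_right) auto

lemma section_eq_subspace:
  assumes "section_eq F P l l'" "vec.subspace P"
  shows "vec.subspace l" "l \<subseteq> P"
proof -
  obtain a where a: "linear_form a" and l: "l = {v \<in> P. a v = 0}"
    using assms(1) by (auto simp: section_eq_def)
  interpret a: Vector_Spaces.linear "(*s)" "(*)" a by (fact a)
  show "vec.subspace l"
    using assms(2) unfolding l vec.subspace_def by (auto simp: a.zero a.add a.scale)
  show "l \<subseteq> P"
    by (auto simp: l)
qed

text \<open>
  For \<open>v \<in> l\<close> and \<open>x \<in> P\<close>, the equation \<open>fermat_cubic = c * a\<^sup>2 * b\<close> at \<open>x + v\<close> and \<open>x - v\<close> has the right-hand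
  sides \<open>c * (a x)\<^sup>2 * (b x \<plusminus> b v)\<close>, since \<open>a v = 0\<close>. Comparing the even parts in \<open>v\<close> yields the first
  equation, comparing the odd parts the second.
\<close>

lemma section_expansion:
  assumes sec: "section_eq fermat_cubic P l l'" and P: "vec.subspace P"
    and v: "v \<in> l" and x: "x \<in> P"
  shows "polar v v x = 0" and "v \<in> l' \<Longrightarrow> polar v x x = 0"
proof -
  obtain a b c where a: "linear_form a" and b: "linear_form b"
    and l: "l = {v \<in> P. a v = 0}" and l': "l' = {v \<in> P. b v = 0}"
    and F: "\<And>v. v \<in> P \<Longrightarrow> fermat_cubic v = c * ((a v)\<^sup>2 * b v)"
    using sec by (auto simp: section_eq_def)
  interpret a: Vector_Spaces.linear "(*s)" "(*)" a by (fact a)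
  interpret b: Vector_Spaces.linear "(*s)" "(*)" b by (fact b)
  have vP: "v \<in> P" and av: "a v = 0"
    using v by (auto simp: l)
  have "fermat_cubic (x + v) = c * ((a x)\<^sup>2 * (b x + b v))"
    using F[of "x + v"] x vP P av by (simp add: vec.subspace_add a.add b.add)
  moreover have "fermat_cubic (x - v) = c * ((a x)\<^sup>2 * (b x - b v))"
    using F[of "x - v"] x vP P av by (simp add: vec.subspace_diff a.diff b.diff)
  moreover have "fermat_cubic v = 0" and "fermat_cubic x = c * ((a x)\<^sup>2 * b x)"
    using F[OF vP] F[OF x] av by simp_all
  moreover have "fermat_cubic (x - v)
      = fermat_cubic x - 3 * polar v x x + 3 * polar v v x - fermat_cubic v"
    by (simp add: fermat_cubic_def polar_def power3_eq_cube algebra_simps sum.distrib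
        sum_subtractf sum_distrib_left)
  moreover note fermat_cubic_add[of x v]
  ultimately have plus: "polar v x x + polar v v x = c * (a x)\<^sup>2 * b v / 3"
    and minus: "polar v x x - polar v v x = c * (a x)\<^sup>2 * b v / 3"
    by (simp_all add: algebra_simps)
  then show "polar v v x = 0"
    by (simp add: algebra_simps)
  moreover assume "v \<in> l'"
  ultimately show "polar v x x = 0"
    using plus by (simp add: l')
qed

lemma section_polar_eq_0:
  assumes sec: "section_eq fermat_cubic P l l'" and P: "vec.subspace P"
    and v: "v \<in> l" "v' \<in> l" and w: "w \<in> P"
  shows "polar v v' w = 0"
proof -
  have "polar (v + v') (v + v') w = polar v v w + 2 * polar v v' w + polar v' v' w"
    by (simp add: polar_def algebra_simps sum.distrib sum_distrib_left)
  moreover have "v + v' \<in> l"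
    using section_eq_subspace(1)[OF sec P] v by (simp add: vec.subspace_add)
  ultimately show ?thesis
    using v w by (simp add: section_expansion(1)[OF sec P])
qed

section \<open>Annihilators and binary quadratic forms\<close>

text \<open>
  The cross product of the coefficient vectors is a solution. If its third entry \<open>p q' - q p'\<close> is
  zero, the two equations in \<open>a\<close> and \<open>b\<close> alone are dependent and have a nontrivial solution with
  \<open>c = 0\<close>.
\<close>

lemma two_equations_three_unknowns:
  fixes p q r p' q' r' :: "'a :: field"
  shows "\<exists>a b c. (a, b, c) \<noteq> (0, 0, 0) \<and> a * p + b * q + c * r = 0 \<and> a * p' + b * q' + c * r' = 0"
proof -
  consider "p \<noteq> 0 \<or> q \<noteq> 0" | "p = 0" "q = 0" "p' \<noteq> 0 \<or> q' \<noteq> 0" | "p = 0" "q = 0" "p' = 0" "q' = 0"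
    by blast
  then show ?thesis
  proof cases
    case 1
    show ?thesis
    proof (cases "p * q' = q * p'")
      case True
      then show ?thesis
        using 1 by (intro exI[of _ "- q"] exI[of _ p] exI[of _ 0]) (auto simp: algebra_simps)
    next
      case False
      then show ?thesis
        by (intro exI[of _ "q * r' - r * q'"] exI[of _ "r * p' - p * r'"] exI[of _ "p * q' - q * p'"])
          (auto simp: algebra_simps)
    qed
  next
    case 2
    then show ?thesis
      by (intro exI[of _ "- q'"] exI[of _ p'] exI[of _ 0]) auto
  next
    case 3
    then show ?thesis
      by (intro exI[of _ 1] exI[of _ 0] exI[of _ 0]) auto
  qed
qed

text \<open>
  The annihilator of a three-dimensional space in \<open>\<complex>\<^sup>5\<close> has dimension two: extending a basis of \<open>P\<close>
  by \<open>x\<close> and \<open>y\<close> to a basis of \<open>\<complex>\<^sup>5\<close>, an annihilator of \<open>P\<close> that also annihilates \<open>x\<close> and \<open>y\<close> is zero,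
  and these are two linear conditions on a combination of three vectors. The pairing is
  \<open>polar 1\<close>, where \<open>1\<close> is the vector with all entries one.
\<close>

lemma annihilator_of_plane_dependent:
  fixes e\<^sub>1 e\<^sub>2 e\<^sub>3 :: "complex^5"
  assumes dim: "vec.dim P = 3"
    and ann: "\<And>w. w \<in> P \<Longrightarrow> polar 1 e\<^sub>1 w = 0 \<and> polar 1 e\<^sub>2 w = 0 \<and> polar 1 e\<^sub>3 w = 0"
  shows "\<exists>a b c. (a, b, c) \<noteq> (0, 0, 0) \<and> a *s e\<^sub>1 + b *s e\<^sub>2 + c *s e\<^sub>3 = 0"
proof -
  obtain B where B: "B \<subseteq> P" "vec.independent B" "card B = 3"
    using vec.basis_exists[of P] dim by metis
  obtain C where C: "B \<subseteq> C" "vec.independent C" "UNIV \<subseteq> vec.span C"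
    using vec.maximal_independent_subset_extend[of B UNIV] B by auto
  have "card C = 5"
    using vec.dim_unique[of C UNIV, OF _ C(3,2) refl] by (simp only: vec_dim_card) simp
  moreover have "finite B"
    using B(3) by (intro card_ge_0_finite) simp
  ultimately have "card (C - B) = 2"
    using C(1) B(3) by (simp add: card_Diff_subset)
  then obtain x y where xy: "C - B = {x, y}"
    by (auto simp: card_2_iff)
  obtain a b c where abc: "(a, b, c) \<noteq> (0, 0, 0)"
    "a * polar 1 x e\<^sub>1 + b * polar 1 x e\<^sub>2 + c * polar 1 x e\<^sub>3 = 0"
    "a * polar 1 y e\<^sub>1 + b * polar 1 y e\<^sub>2 + c * polar 1 y e\<^sub>3 = 0"
    using two_equations_three_unknowns by meson
  define e where "e = a *s e\<^sub>1 + b *s e\<^sub>2 + c *s e\<^sub>3"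
  have e: "polar 1 v e = a * polar 1 v e\<^sub>1 + b * polar 1 v e\<^sub>2 + c * polar 1 v e\<^sub>3" for v
    by (simp add: e_def polar_add polar_scale)
  have "polar 1 v e = 0" if "v \<in> C" for v
  proof (cases "v \<in> B")
    case True
    then show ?thesis
      using ann[of v] B(1) by (auto simp: e polar_commute(2)[of 1 v])
  next
    case False
    then show ?thesis
      using that xy abc by (auto simp: e)
  qed
  moreover have "vec.subspace {v. polar 1 v e = 0}"
    by (simp add: vec.subspace_def polar_commute(2)[of 1 _ e] polar_add polar_scale)
      (simp add: polar_def)
  ultimately have "vec.span C \<subseteq> {v. polar 1 v e = 0}"
    by (intro vec.span_minimal) auto
  then have "polar 1 (axis i 1) e = 0" for i
    using C(3) by auto
  moreover have "polar 1 (axis i 1) e = e $ i" for i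
    by (simp add: polar_def axis_def if_distrib[of "\<lambda>x. x * _"] cong: if_cong)
  ultimately have "e = 0"
    by (simp add: vec_eq_iff)
  then show ?thesis
    using abc(1) unfolding e_def by blast
qed

lemma binary_quadratic_form_factors:
  fixes \<alpha> \<beta> \<gamma> :: complex
  assumes "(\<alpha>, \<beta>, \<gamma>) \<noteq> (0, 0, 0)"
  shows "\<exists>a b c d. (a, b) \<noteq> (0, 0) \<and> (c, d) \<noteq> (0, 0) \<and>
    (\<forall>x y. (a * x + b * y) * (c * x + d * y) = \<alpha> * x\<^sup>2 + \<beta> * (x * y) + \<gamma> * y\<^sup>2)"
proof (cases "\<alpha> = 0")
  case True
  then show ?thesis
    using assms by (intro exI[of _ 0] exI[of _ 1] exI[of _ \<beta>] exI[of _ \<gamma>])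
      (auto simp: algebra_simps power2_eq_square)
next
  case False
  define s where "s = csqrt (\<beta>\<^sup>2 - 4 * \<alpha> * \<gamma>)"
  have s: "s\<^sup>2 = \<beta>\<^sup>2 - 4 * \<alpha> * \<gamma>"
    by (simp add: s_def)
  have "(\<alpha> * x + (\<beta> - s) / 2 * y) * (1 * x + (\<beta> + s) / (2 * \<alpha>) * y)
      = \<alpha> * x\<^sup>2 + \<beta> * (x * y) + (\<beta>\<^sup>2 - s\<^sup>2) / (4 * \<alpha>) * y\<^sup>2" for x y
    using False by (simp add: field_simps power2_eq_square)
  moreover have "(\<beta>\<^sup>2 - s\<^sup>2) / (4 * \<alpha>) = \<gamma>"
    using False by (simp add: s)
  ultimately show ?thesis
    using False by (intro exI[of _ \<alpha>] exI[of _ "(\<beta> - s) / 2"] exI[of _ 1]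
        exI[of _ "(\<beta> + s) / (2 * \<alpha>)"]) auto
qed

lemma span_pair_of_disjoint_support:
  fixes p q :: "complex^5"
  assumes "p \<noteq> 0" "q \<noteq> 0" "\<And>i. p $ i * q $ i = 0"
  shows "vec.dim (vec.span {p, q}) = 2"
proof -
  have "p \<notin> vec.span {q}"
  proof
    assume "p \<in> vec.span {q}"
    then obtain c where p: "p = c *s q"
      by (auto simp: vec.span_singleton)
    then have "c * (q $ i)\<^sup>2 = 0" for i
      using assms(3)[of i] by (simp add: power2_eq_square mult_ac)
    then show False
      using p assms(1) by (auto simp: vec_eq_iff)
  qed
  then show ?thesis
    using assms(2) by (simp add: vec.dim_insert)
qed

section \<open>Number of nonzero coordinates\<close>

lemma card_support_ge_2:
  assumes "p \<noteq> 0" "fermat_cubic p = 0"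
  shows "card {i. p $ i \<noteq> 0} \<ge> 2"
proof (rule ccontr)
  assume "\<not> ?thesis"
  moreover have "card {i. p $ i \<noteq> 0} \<noteq> 0"
    using assms(1) by (auto simp: vec_eq_iff)
  ultimately have "card {i. p $ i \<noteq> 0} = 1"
    by linarith
  then obtain i where i: "{i. p $ i \<noteq> 0} = {i}"
    by (auto simp: card_1_singleton_iff)
  then have "fermat_cubic p = p $ i * p $ i * p $ i"
    unfolding fermat_cubic_polar using polar_supported[of "{i}" p p p] by auto
  then show False
    using i assms(2) by auto
qed

text \<open>
  If \<open>p\<close> had three nonzero coordinates \<open>h, i, j\<close>, the two remaining ones would be the support of \<open>q\<close>.
  Subtract multiples of \<open>p\<close> and \<open>q\<close> from \<open>u\<close> to get \<open>w \<in> P\<close> with a zero in position \<open>h\<close> and in one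
  position of the support of \<open>q\<close>; then \<open>polar q q w = 0\<close> makes the other one vanish too, and \<open>w\<close> lives
  on \<open>{i, j}\<close>. The equations \<open>p\<^sub>i\<^sup>2 w\<^sub>i + p\<^sub>j\<^sup>2 w\<^sub>j = 0\<close> and \<open>p\<^sub>i w\<^sub>i\<^sup>2 + p\<^sub>j w\<^sub>j\<^sup>2 = 0\<close> then force
  \<open>p\<^sub>i\<^sup>3 + p\<^sub>j\<^sup>3 = 0\<close>, so \<open>p\<^sub>h\<^sup>3 = 0\<close> as \<open>p\<close> is a zero of the cubic, a contradiction.
\<close>

lemma card_support_le_2:
  fixes p q u :: "complex^5"
  assumes P: "vec.subspace P" "p \<in> P" "q \<in> P" "u \<in> P" and u: "u \<notin> vec.span {p, q}"
    and disj: "\<And>i. p $ i * q $ i = 0" and "p \<noteq> 0" "q \<noteq> 0"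
    and F: "fermat_cubic p = 0" "fermat_cubic q = 0"
    and p: "\<And>w. w \<in> P \<Longrightarrow> polar p p w = 0 \<and> polar p w w = 0"
    and q: "\<And>w. w \<in> P \<Longrightarrow> polar q q w = 0"
  shows "card {i. p $ i \<noteq> 0} \<le> 2"
proof (rule ccontr)
  let ?S = "{i. p $ i \<noteq> 0}" and ?T = "{i. q $ i \<noteq> 0}"
  assume "\<not> card ?S \<le> 2"
  moreover have "card ?T \<ge> 2"
    using card_support_ge_2 \<open>q \<noteq> 0\<close> F by blast
  moreover have ST: "?S \<inter> ?T = {}"
    using disj by auto
  have "card (?S \<union> ?T) \<le> CARD(5)"
    by (intro card_mono) auto
  with ST have "card ?S + card ?T \<le> 5"
    by (simp add: card_Un_disjoint)
  ultimately have card: "card ?S = 3" "card ?T = 2"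
    by linarith+
  then have "card (?S \<union> ?T) = CARD(5)"
    using ST by (simp add: card_Un_disjoint)
  then have all: "?S \<union> ?T = UNIV"
    by (intro card_subset_eq) auto
  obtain h i j where hij: "?S = {h, i, j}" "h \<noteq> i" "h \<noteq> j" "i \<noteq> j"
    using card(1) by (auto simp: card_3_iff)
  obtain k m where km: "?T = {k, m}" "k \<noteq> m"
    using card(2) by (auto simp: card_2_iff)
  have nz: "p $ h \<noteq> 0" "p $ i \<noteq> 0" "p $ j \<noteq> 0" "q $ k \<noteq> 0" "q $ m \<noteq> 0"
    using hij km by auto
  have supp: "p $ n = 0" if "n \<notin> {h, i, j}" for n
    using hij(1) that by auto
  have suppq: "q $ n = 0" if "n \<notin> {k, m}" for n
    using km(1) that by auto
  define w where "w = u - (u $ h / p $ h) *s p - (u $ k / q $ k) *s q"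
  have "w \<in> P"
    using P unfolding w_def by (intro vec.subspace_diff vec.subspace_scale)
  have "w \<noteq> 0"
  proof
    assume "w = 0"
    then have "u = (u $ h / p $ h) *s p + (u $ k / q $ k) *s q"
      by (simp add: w_def algebra_simps)
    also have "\<dots> \<in> vec.span {p, q}"
      by (intro vec.span_add vec.span_scale vec.span_base) auto
    finally show False
      using u by simp
  qed
  have "q $ h = 0" "p $ k = 0"
    using disj[of h] disj[of k] nz by auto
  then have w0: "w $ h = 0" "w $ k = 0"
    using nz by (simp_all add: w_def)
  have "polar q q w = q $ m * q $ m * w $ m"
    using polar_supported[of "{k, m}" q q w] suppq km(2) w0 by simp
  then have wm: "w $ m = 0"
    using q[OF \<open>w \<in> P\<close>] nz by simp
  have ij: "p $ i * p $ i * w $ i + p $ j * p $ j * w $ j = 0"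
    "p $ i * w $ i * w $ i + p $ j * w $ j * w $ j = 0"
    "p $ h * p $ h * p $ h + (p $ i * p $ i * p $ i + p $ j * p $ j * p $ j) = 0"
    using p[OF \<open>w \<in> P\<close>] F(1) w0 hij(2-) supp polar_supported[of "{h, i, j}" p]
    by (simp_all add: fermat_cubic_polar)
  have wj: "w $ j = - (p $ i * p $ i * w $ i) / (p $ j * p $ j)"
    using ij(1) nz by (simp add: field_simps eq_neg_iff_add_eq_0)
  have wi: "w $ i \<noteq> 0"
  proof
    assume "w $ i = 0"
    then have "w $ n = 0" for n
      using all[unfolded hij(1) km(1)] wj w0 wm by (cases "n = j") auto
    then show False
      using \<open>w \<noteq> 0\<close> by (simp add: vec_eq_iff)
  qed
  have "p $ i * w $ i * w $ i * (p $ i ^ 3 + p $ j ^ 3) = 0"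
    using ij(2) nz unfolding wj by (simp add: field_simps power2_eq_square power3_eq_cube)
  then have "p $ i ^ 3 + p $ j ^ 3 = 0"
    using nz wi by simp
  then show False
    using ij(3) nz by (simp add: power3_eq_cube)
qed

section \<open>Equations of triple lines\<close>

text \<open>
  In coordinates on \<open>l\<close> the five coordinate forms are points \<open>(p\<^sub>i, q\<^sub>i)\<close>, and a linear relation between
  \<open>p\<^sup>2\<close>, \<open>pq\<close>, \<open>q\<^sup>2\<close> is a quadratic form vanishing at all of them. If it is the product of the linear
  forms \<open>a x + b y\<close> and \<open>c x + d y\<close>, then \<open>a p + b q\<close> and \<open>c p + d q\<close> have disjoint supports. They are
  nonzero, hence independent: a double root cannot occur.
\<close>

lemma triple_section_disjoint_basis:
  assumes P: "vec.subspace P" "vec.dim P = 3" and l: "vec.dim l = 2"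
    and sec: "section_eq fermat_cubic P l l'"
  shows "\<exists>p q. p \<noteq> 0 \<and> q \<noteq> 0 \<and> (\<forall>i. p $ i * q $ i = 0) \<and> l = vec.span {p, q}"
proof -
  note l_sub = section_eq_subspace[OF sec P(1)]
  obtain B where B: "B \<subseteq> l" "vec.independent B" "card B = 2"
    using vec.basis_exists[of l] l by metis
  then obtain p q where pq: "B = {p, q}" "p \<noteq> q"
    by (auto simp: card_2_iff)
  define prod :: "complex^5 \<Rightarrow> complex^5 \<Rightarrow> complex^5" where "prod v w = (\<chi> i. v $ i * w $ i)" for v w
  have polar_prod: "polar 1 (prod v v') w = polar v v' w" for v v' w
    by (simp add: polar_def prod_def)
  obtain \<alpha> \<beta> \<gamma> where nz: "(\<alpha>, \<beta>, \<gamma>) \<noteq> (0, 0, 0)"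
    and rel: "\<alpha> *s prod p p + \<beta> *s prod p q + \<gamma> *s prod q q = 0"
    using annihilator_of_plane_dependent[OF P(2), of "prod p p" "prod p q" "prod q q"]
      section_polar_eq_0[OF sec P(1)] B(1) pq(1) by (auto simp: polar_prod)
  obtain a b c d where ab: "(a, b) \<noteq> (0, 0)" and cd: "(c, d) \<noteq> (0, 0)"
    and fac: "\<And>x y. (a * x + b * y) * (c * x + d * y) = \<alpha> * x\<^sup>2 + \<beta> * (x * y) + \<gamma> * y\<^sup>2"
    using binary_quadratic_form_factors[OF nz] by blast
  have comb_nz: "s *s p + t *s q \<noteq> 0" if "(s, t) \<noteq> (0, 0)" for s t
  proof
    assume eq: "s *s p + t *s q = 0"
    have p: "p \<notin> vec.span {q}" "q \<noteq> 0"
      using B(2) pq by (auto simp: vec.independent_insert vec.dependent_single)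
    have "s = 0"
    proof (rule ccontr)
      assume "s \<noteq> 0"
      have "s *s p = (- t) *s q"
        using eq by (simp add: add_eq_0_iff)
      then have "inverse s *s (s *s p) = inverse s *s ((- t) *s q)"
        by (rule arg_cong)
      then have "p = (inverse s * (- t)) *s q"
        using \<open>s \<noteq> 0\<close> by (simp only: vec.scale_scale) simp
      then show False
        using p by (metis insertI1 vec.span_base vec.span_scale)
    qed
    then show False
      using eq p that by simp
  qed
  let ?p = "a *s p + b *s q" and ?q = "c *s p + d *s q"
  have "?p $ i * ?q $ i = (\<alpha> *s prod p p + \<beta> *s prod p q + \<gamma> *s prod q q) $ i" for i
    using fac[of "p $ i" "q $ i"] by (simp add: prod_def power2_eq_square)
  then have disj: "?p $ i * ?q $ i = 0" for i
    unfolding rel by simp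
  have in_l: "?p \<in> l" "?q \<in> l"
    using B(1) pq(1) l_sub(1) by (auto intro!: vec.subspace_add vec.subspace_scale)
  have nz': "?p \<noteq> 0" "?q \<noteq> 0"
    using comb_nz ab cd by auto
  have "vec.span {?p, ?q} \<subseteq> l"
    using in_l l_sub(1) by (intro vec.span_minimal) auto
  then have "vec.span {?p, ?q} = l"
    using l l_sub(1) span_pair_of_disjoint_support[OF nz' disj]
    by (intro vec.subspace_dim_equal vec.subspace_span) auto
  then show ?thesis
    using disj nz' by (intro exI[of _ ?p] exI[of _ ?q]) simp
qed

definition paired_line :: "5 \<Rightarrow> 5 \<Rightarrow> complex \<Rightarrow> 5 \<Rightarrow> 5 \<Rightarrow> complex \<Rightarrow> (complex^5) set" where
  "paired_line i j \<alpha> k m \<beta> =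
     {x. x $ j = - \<alpha> * x $ i \<and> x $ m = - \<beta> * x $ k \<and> (\<forall>n. n \<notin> {i, j, k, m} \<longrightarrow> x $ n = 0)}"

definition pair_vec :: "5 \<Rightarrow> 5 \<Rightarrow> complex \<Rightarrow> complex^5" where
  "pair_vec i j \<alpha> = (\<chi> n. if n = i then 1 else if n = j then - \<alpha> else 0)"

lemma paired_line_eq_span:
  assumes "distinct [i, j, k, m]"
  shows "paired_line i j \<alpha> k m \<beta> = vec.span {pair_vec i j \<alpha>, pair_vec k m \<beta>}"
proof (intro equalityI subsetI)
  fix x assume x: "x \<in> paired_line i j \<alpha> k m \<beta>"
  have "x = x $ i *s pair_vec i j \<alpha> + x $ k *s pair_vec k m \<beta>"
    using x assms by (auto simp: vec_eq_iff paired_line_def pair_vec_def)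
  also have "\<dots> \<in> vec.span {pair_vec i j \<alpha>, pair_vec k m \<beta>}"
    by (intro vec.span_add vec.span_scale vec.span_base) auto
  finally show "x \<in> vec.span {pair_vec i j \<alpha>, pair_vec k m \<beta>}" .
next
  have "vec.subspace (paired_line i j \<alpha> k m \<beta>)"
    by (auto simp: vec.subspace_def paired_line_def algebra_simps)
  moreover have "{pair_vec i j \<alpha>, pair_vec k m \<beta>} \<subseteq> paired_line i j \<alpha> k m \<beta>"
    using assms by (auto simp: paired_line_def pair_vec_def)
  ultimately have "vec.span {pair_vec i j \<alpha>, pair_vec k m \<beta>} \<subseteq> paired_line i j \<alpha> k m \<beta>"
    by (intro vec.span_minimal)
  then show "x \<in> paired_line i j \<alpha> k m \<beta>" if "x \<in> vec.span {pair_vec i j \<alpha>, pair_vec k m \<beta>}" for x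
    using that by blast
qed

lemma dim_paired_line:
  assumes "distinct [i, j, k, m]"
  shows "vec.dim (paired_line i j \<alpha> k m \<beta>) = 2"
proof -
  have "pair_vec i j \<alpha> $ i \<noteq> 0" "pair_vec k m \<beta> $ k \<noteq> 0"
    by (simp_all add: pair_vec_def)
  then have "pair_vec i j \<alpha> \<noteq> 0" "pair_vec k m \<beta> \<noteq> 0"
    by (metis zero_index)+
  then show ?thesis
    unfolding paired_line_eq_span[OF assms]
    using assms by (intro span_pair_of_disjoint_support) (auto simp: pair_vec_def)
qed

lemma triple_line_is_paired:
  assumes "triple_line fermat_cubic l"
  shows "\<exists>i j k m \<alpha> \<beta>. distinct [i, j, k, m] \<and> \<alpha> ^ 3 = 1 \<and> \<beta> ^ 3 = 1 \<and>
    l = paired_line i j \<alpha> k m \<beta>"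
proof -
  obtain P where P: "vec.subspace P" "vec.dim P = 3" "l \<subseteq> P"
    and sec: "section_eq fermat_cubic P l l"
    using assms by (auto simp: triple_line_def proj_subspace_def)
  have l: "vec.dim l = 2" "\<And>v. v \<in> l \<Longrightarrow> fermat_cubic v = 0"
    using assms by (auto simp: triple_line_def second_type_def line_on_def proj_subspace_def)
  obtain p q where pq: "p \<noteq> 0" "q \<noteq> 0" "\<And>i. p $ i * q $ i = 0" and lpq: "l = vec.span {p, q}"
    using triple_section_disjoint_basis[OF P(1,2) l(1) sec] by blast
  have "p \<in> l" "q \<in> l"
    by (auto simp: lpq vec.span_base)
  have "\<not> P \<subseteq> l"
    using vec.dim_subset[of P l] P(2) l(1) by auto
  then obtain u where u: "u \<in> P" "u \<notin> vec.span {p, q}"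
    unfolding lpq by blast
  note polar_0 = section_expansion[OF sec P(1)]
  note F = l(2)[OF \<open>p \<in> l\<close>] l(2)[OF \<open>q \<in> l\<close>]
  have "card {i. p $ i \<noteq> 0} \<le> 2"
    using P \<open>p \<in> l\<close> \<open>q \<in> l\<close> u pq F polar_0 by (intro card_support_le_2[of P p q u]) auto
  moreover have "card {i. q $ i \<noteq> 0} \<le> 2"
    using P \<open>p \<in> l\<close> \<open>q \<in> l\<close> u pq F polar_0
    by (intro card_support_le_2[of P q p u]) (auto simp: insert_commute mult.commute)
  ultimately have "card {i. p $ i \<noteq> 0} = 2" "card {i. q $ i \<noteq> 0} = 2"
    using card_support_ge_2 pq F by (simp_all add: le_antisym)
  then obtain i j k m where ij: "{i. p $ i \<noteq> 0} = {i, j}" "i \<noteq> j"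
    and km: "{i. q $ i \<noteq> 0} = {k, m}" "k \<noteq> m"
    by (metis card_2_iff)
  have dist: "distinct [i, j, k, m]"
    using ij km pq(3) by auto
  have nz: "p $ i \<noteq> 0" "p $ j \<noteq> 0" "q $ k \<noteq> 0" "q $ m \<noteq> 0"
    using ij km by auto
  have supp: "p $ n = 0 \<longleftrightarrow> n \<notin> {i, j}" "q $ n = 0 \<longleftrightarrow> n \<notin> {k, m}" for n
    using ij(1) km(1) by auto
  have cubes: "p $ i ^ 3 + p $ j ^ 3 = 0" "q $ k ^ 3 + q $ m ^ 3 = 0"
    using F ij(2) km(2) supp polar_supported[of "{i, j}" p p p] polar_supported[of "{k, m}" q q q]
    by (simp_all add: fermat_cubic_polar power3_eq_cube)
  define \<alpha> \<beta> where "\<alpha> = - p $ j / p $ i" and "\<beta> = - q $ m / q $ k"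
  have "\<alpha> ^ 3 = 1" "\<beta> ^ 3 = 1"
    using cubes nz by (simp_all add: \<alpha>_def \<beta>_def power_divide field_simps neg_eq_iff_add_eq_0)
  moreover have zeros: "p $ k = 0" "p $ m = 0" "q $ i = 0" "q $ j = 0"
    using supp dist by auto
  have outside: "p $ n = 0" "q $ n = 0" if "n \<notin> {i, j, k, m}" for n
    using supp that by auto
  have "p \<in> paired_line i j \<alpha> k m \<beta>" "q \<in> paired_line i j \<alpha> k m \<beta>"
    using nz by (simp_all add: paired_line_def \<alpha>_def \<beta>_def zeros outside)
  then have "l \<subseteq> paired_line i j \<alpha> k m \<beta>"
    unfolding lpq using paired_line_eq_span[OF dist] by (intro vec.span_minimal) auto
  then have "l = paired_line i j \<alpha> k m \<beta>"
    using l(1) dim_paired_line[OF dist] lpq paired_line_eq_span[OF dist]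
    by (intro vec.subspace_dim_equal) auto
  ultimately show ?thesis
    using dist by blast
qed

lemma polar_pair_vec:
  assumes "i \<noteq> j"
  shows "polar (pair_vec i j \<alpha>) (pair_vec i j \<alpha>) w = w $ i + \<alpha>\<^sup>2 * w $ j"
  using assms polar_supported[of "{i, j}" "pair_vec i j \<alpha>" "pair_vec i j \<alpha>" w]
  by (simp add: pair_vec_def power2_eq_square)

text \<open>
  With \<open>r\<close> the fifth index, the summands of \<open>x\<^sub>i\<close> and \<open>x\<^sub>j\<close> cancel on \<open>P\<close>, and so do those of \<open>x\<^sub>k\<close> and
  \<open>x\<^sub>m\<close>, which leaves \<open>x\<^sub>r\<^sup>3\<close>. For uniqueness, a plane \<open>Q\<close> with a section \<open>2l + l'\<close> satisfies
  \<open>polar v v w = 0\<close> for \<open>v \<in> l\<close> and \<open>w \<in> Q\<close>; taking for \<open>v\<close> the two spanning vectors of \<open>l\<close> gives the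
  equations of \<open>P\<close>, whence \<open>Q \<subseteq> P\<close>.
\<close>

lemma paired_line_is_triple:
  assumes dist: "distinct [i, j, k, m]" and cubes: "\<alpha> ^ 3 = 1" "\<beta> ^ 3 = 1"
  shows "triple_line fermat_cubic (paired_line i j \<alpha> k m \<beta>)"
proof -
  let ?l = "paired_line i j \<alpha> k m \<beta>"
  define P where "P = {x :: complex^5. x $ j = - \<alpha> * x $ i \<and> x $ m = - \<beta> * x $ k}"
  have "card (- {i, j, k, m}) = 1"
    using dist by (simp add: Compl_eq_Diff_UNIV card_Diff_subset)
  then obtain r where r: "- {i, j, k, m} = {r}"
    by (auto simp: card_1_singleton_iff)
  then have UNIV5: "UNIV = {i, j, k, m, r}" and r_dist: "r \<notin> {i, j, k, m}"
    by auto
  have dist5: "distinct [i, j, k, m, r]"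
    using dist r_dist by auto
  have other: "n \<notin> {i, j, k, m} \<longleftrightarrow> n = r" for n
    using r by blast
  have P_sub: "vec.subspace P"
    by (simp add: vec.subspace_def P_def distrib_left mult.left_commute)
  have l_eq: "?l = {x \<in> P. x $ r = 0}"
    unfolding paired_line_def P_def other by auto
  have l_dim: "vec.dim ?l = 2"
    by (rule dim_paired_line[OF dist])
  have l_sub: "vec.subspace ?l"
    by (simp add: paired_line_eq_span[OF dist])
  have P_span: "P = vec.span (insert (axis r 1) ?l)"
  proof (intro equalityI subsetI)
    fix x assume "x \<in> P"
    then have "x - x $ r *s axis r 1 \<in> ?l"
      using r_dist by (auto simp: l_eq P_def axis_def)
    then show "x \<in> vec.span (insert (axis r 1) ?l)"
      by (metis vec.span_base vec.span_breakdown_eq)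
  next
    have "insert (axis r 1) ?l \<subseteq> P"
      using r_dist by (auto simp: l_eq P_def axis_def)
    then show "x \<in> P" if "x \<in> vec.span (insert (axis r 1) ?l)" for x
      using vec.span_minimal[OF _ P_sub] that by blast
  qed
  have "axis r 1 \<notin> vec.span ?l"
    using l_sub by (simp add: vec.span_eq_iff[THEN iffD2] l_eq)
  then have P_dim: "vec.dim P = 3"
    by (simp add: P_span vec.dim_insert l_dim)
  have F: "fermat_cubic x = (x $ r) ^ 3" if "x \<in> P" for x
  proof -
    have "fermat_cubic x = x $ i ^ 3 + (- \<alpha> * x $ i) ^ 3 + (x $ k ^ 3 + (- \<beta> * x $ k) ^ 3) + x $ r ^ 3"
      using that dist5 by (simp add: fermat_cubic_def UNIV5 P_def)
    also have "(- \<alpha> * x $ i) ^ 3 = - (x $ i ^ 3)"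
      using cubes by (simp add: power_mult_distrib)
    also have "(- \<beta> * x $ k) ^ 3 = - (x $ k ^ 3)"
      using cubes by (simp add: power_mult_distrib)
    finally show ?thesis
      by simp
  qed
  have lin: "linear_form (\<lambda>x. x $ r)"
    by unfold_locales (simp_all add: algebra_simps)
  have sec: "section_eq fermat_cubic P ?l ?l"
    unfolding section_eq_def using lin
    by (intro exI[of _ "\<lambda>x. x $ r"] conjI exI[of _ 1]) (auto simp: l_eq F power3_eq_cube power2_eq_square)
  have unique: "Q = P" if Q: "proj_plane Q" "?l \<subseteq> Q" "section_eq fermat_cubic Q ?l l'" for Q l'
  proof (rule vec.subspace_dim_equal)
    show "Q \<subseteq> P"
    proof
      fix w assume w: "w \<in> Q"
      have pv: "pair_vec i j \<alpha> \<in> ?l" "pair_vec k m \<beta> \<in> ?l"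
        by (auto simp: paired_line_eq_span[OF dist] vec.span_base)
      then have "polar (pair_vec i j \<alpha>) (pair_vec i j \<alpha>) w = 0"
        "polar (pair_vec k m \<beta>) (pair_vec k m \<beta>) w = 0"
        using Q w section_expansion(1)[of Q ?l l'] by (auto simp: proj_subspace_def)
      then have eqs: "w $ i + \<alpha>\<^sup>2 * w $ j = 0" "w $ k + \<beta>\<^sup>2 * w $ m = 0"
        using dist by (simp_all add: polar_pair_vec)
      \<comment> \<open>Multiplying \<open>w\<^sub>i + \<alpha>\<^sup>2 w\<^sub>j = 0\<close> by \<open>\<alpha>\<close> clears the square, as \<open>\<alpha>\<^sup>3 = 1\<close>.\<close>
      have "\<alpha> * w $ i + w $ j = \<alpha> * (w $ i + \<alpha>\<^sup>2 * w $ j) + (1 - \<alpha> ^ 3) * w $ j"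
        "\<beta> * w $ k + w $ m = \<beta> * (w $ k + \<beta>\<^sup>2 * w $ m) + (1 - \<beta> ^ 3) * w $ m"
        by (simp_all add: algebra_simps power2_eq_square power3_eq_cube)
      then show "w \<in> P"
        using eqs cubes by (simp add: P_def eq_neg_iff_add_eq_0 add.commute)
    qed
  qed (use Q(1) P_sub P_dim in \<open>simp_all add: proj_subspace_def\<close>)
  have "proj_plane P" "proj_line ?l" "?l \<subseteq> P"
    using P_sub P_dim l_sub l_dim by (auto simp: proj_subspace_def l_eq)
  moreover have "fermat_cubic v = 0" if "v \<in> ?l" for v
    using that F by (simp add: l_eq)
  ultimately have "line_on fermat_cubic ?l"
    "proj_plane P \<and> ?l \<subseteq> P \<and> (\<exists>l'. proj_line l' \<and> l' \<subseteq> P \<and> section_eq fermat_cubic P ?l l')"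
    using sec by (auto simp: line_on_def)
  then show ?thesis
    unfolding triple_line_def second_type_def using unique sec by blast
qed

section \<open>Counting the lines\<close>

lemma paired_line_flip:
  assumes "\<alpha> ^ 3 = 1"
  shows "paired_line i j \<alpha> k m \<beta> = paired_line j i (\<alpha>\<^sup>2) k m \<beta>"
proof -
  have "x = - \<alpha> * y \<longleftrightarrow> y = - \<alpha>\<^sup>2 * x" for x y
  proof -
    have "\<alpha> * (\<alpha> * (\<alpha> * z)) = z" for z
      using assms by (simp add: power3_eq_cube mult.assoc)
    then show ?thesis
      by (auto simp: power2_eq_square mult.assoc)
  qed
  then show ?thesis
    unfolding paired_line_def by (simp add: insert_commute)
qed

lemma paired_line_commute: "paired_line i j \<alpha> k m \<beta> = paired_line k m \<beta> i j \<alpha>"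
  by (auto simp: paired_line_def)

text \<open>
  As \<open>\<alpha>\<close> and \<open>\<beta>\<close> are nonzero, the support of a vector of the line is a union of some of the sets
  \<open>{i, j}\<close>, \<open>{k, m}\<close>. A vector with a two-element support is therefore a multiple of one of the
  spanning vectors, and its normalisation at the smaller index fixes the multiple. This is how
  the parameters are recovered from the line.
\<close>

lemma pair_vec_mem_paired_line:
  assumes "distinct [i, j, k, m]" "i' < j'" "i < j" "k < m" "\<alpha>' \<noteq> 0" "\<alpha> \<noteq> 0" "\<beta> \<noteq> 0"
    and "pair_vec i' j' \<alpha>' \<in> paired_line i j \<alpha> k m \<beta>"
  shows "(i', j', \<alpha>') = (i, j, \<alpha>) \<or> (i', j', \<alpha>') = (k, m, \<beta>)"
proof -
  have "pair_vec i' j' \<alpha>' $ i' = 1"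
    by (simp add: pair_vec_def)
  then have "i' \<in> {i, j, k, m}"
    using assms(8) unfolding paired_line_def by force
  have eqs: "pair_vec i' j' \<alpha>' $ j = - \<alpha> * pair_vec i' j' \<alpha>' $ i"
    "pair_vec i' j' \<alpha>' $ m = - \<beta> * pair_vec i' j' \<alpha>' $ k"
    using assms(8) by (auto simp: paired_line_def)
  show ?thesis
    using \<open>i' \<in> _\<close> eqs assms(1-7)
    by (auto simp: pair_vec_def split: if_splits)
qed

text \<open>
  Two disjoint pairs of indices, each listed in increasing order and sorted by smaller element, so
  that every unordered choice occurs exactly once.
\<close>

definition pairings :: "(5 \<times> 5 \<times> 5 \<times> 5) set" where
  "pairings = {(i, j, k, m). i < j \<and> k < m \<and> i < k \<and> distinct [i, j, k, m]}"

text \<open>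
  The representation of the index type by integers is strictly increasing, which turns the count
  into an evaluation over quadruples of integers.
\<close>

lemma card_pairings: "card pairings = 15"
proof -
  let ?N = "{(a, b, c, d). {a, b, c, d} \<subseteq> {0..<5::int} \<and> a < b \<and> c < d \<and> a < c \<and> distinct [a, b, c, d]}"
  define xs where "xs = [0..4::int]"
  have xs: "set xs = {0..<5}"
    unfolding xs_def set_upto by auto
  let ?A = "Abs_bit1 :: int \<Rightarrow> 5" and ?R = "Rep_bit1 :: 5 \<Rightarrow> int"
  interpret td: type_definition ?R ?A "{0..<5}"
    using type_definition_bit1[where 'a = 2] by simp
  have "(\<lambda>(i, j, k, m). (?R i, ?R j, ?R k, ?R m)) ` pairings = ?N"
  proof (intro equalityI subsetI)
    fix x assume "x \<in> ?N"
    then obtain a b c d where x: "x = (a, b, c, d)" "(a, b, c, d) \<in> ?N"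
      by auto
    then have "{a, b, c, d} \<subseteq> range ?R"
      by (simp add: td.Rep_range)
    then obtain i j k m where "a = ?R i" "b = ?R j" "c = ?R k" "d = ?R m"
      by auto
    then show "x \<in> (\<lambda>(i, j, k, m). (?R i, ?R j, ?R k, ?R m)) ` pairings"
      using x by (intro image_eqI[of _ _ "(i, j, k, m)"]) (auto simp: pairings_def less_bit1_def)
  qed (use td.Rep in \<open>auto simp: pairings_def less_bit1_def td.Rep_inject\<close>)
  moreover have "inj_on (\<lambda>(i, j, k, m). (?R i, ?R j, ?R k, ?R m)) pairings"
    by (auto simp: inj_on_def td.Rep_inject)
  ultimately have "bij_betw (\<lambda>(i, j, k, m). (?R i, ?R j, ?R k, ?R m)) pairings ?N"
    by (simp add: bij_betw_def)
  then have "card pairings = card ?N"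
    by (rule bij_betw_same_card)
  also have "?N = set (filter (\<lambda>(a, b, c, d). a < b \<and> c < d \<and> a < c \<and> distinct [a, b, c, d])
      (List.product xs (List.product xs (List.product xs xs))))"
    by (auto simp: xs)
  also have "card \<dots> = 15"
    unfolding xs_def by code_simp
  finally show ?thesis .
qed

text \<open>
  Exchanging \<open>i\<close> with \<open>j\<close>, or \<open>k\<close> with \<open>m\<close>, replaces the root of unity by its inverse, which is its
  square; exchanging the two pairs exchanges the roots. So the indices may be put in order.
\<close>

lemma triple_lines_eq:
  "{l. triple_line fermat_cubic l} =
     (\<lambda>((i, j, k, m), \<alpha>, \<beta>). paired_line i j \<alpha> k m \<beta>) `
       (pairings \<times> {\<alpha>. \<alpha> ^ 3 = 1} \<times> {\<beta>. \<beta> ^ 3 = 1})" (is "_ = ?L")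
proof (intro equalityI subsetI)
  fix l assume "l \<in> {l. triple_line fermat_cubic l}"
  then obtain i j k m \<alpha> \<beta> where l: "distinct [i, j, k, m]" "\<alpha> ^ 3 = 1" "\<beta> ^ 3 = 1"
    "l = paired_line i j \<alpha> k m \<beta>"
    using triple_line_is_paired by blast
  have ordered: "paired_line i j \<alpha> k m \<beta> \<in> ?L"
    if A: "distinct [i, j, k, m]" "\<alpha> ^ 3 = 1" "\<beta> ^ 3 = 1" "i < j" "k < m" for i j k m \<alpha> \<beta>
  proof -
    have in_L: "paired_line i j \<alpha> k m \<beta> \<in> ?L"
      if "distinct [i, j, k, m]" "\<alpha> ^ 3 = 1" "\<beta> ^ 3 = 1" "i < j" "k < m" "i < k" for i j k m \<alpha> \<beta>
      using that by (intro image_eqI[of _ _ "((i, j, k, m), \<alpha>, \<beta>)"]) (auto simp: pairings_def)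
    consider "i < k" | "k < i"
      using A(1) by (cases i k rule: linorder_cases) auto
    then show ?thesis
    proof cases
      case 1
      then show ?thesis using in_L A by blast
    next
      case 2
      then show ?thesis
        unfolding paired_line_commute[of i] using A by (intro in_L) auto
    qed
  qed
  have sq: "(z\<^sup>2) ^ 3 = 1" if "z ^ 3 = 1" for z :: complex
    using that by (metis mult.commute power_mult power_one)
  have first: "paired_line i j \<alpha> k m \<beta> \<in> ?L"
    if "distinct [i, j, k, m]" "\<alpha> ^ 3 = 1" "\<beta> ^ 3 = 1" "k < m" for i j k m \<alpha> \<beta>
  proof (cases "i < j")
    case False
    then show ?thesis
      unfolding paired_line_flip[OF that(2)] using that by (intro ordered sq) auto
  qed (use ordered that in blast)
  show "l \<in> ?L"
  proof (cases "k < m")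
    case True
    then show ?thesis using first l by blast
  next
    case False
    then have "m < k"
      using l(1) by auto
    moreover have "l = paired_line i j \<alpha> m k (\<beta>\<^sup>2)"
      using l(4) paired_line_commute paired_line_flip[OF l(3)] by metis
    ultimately show ?thesis
      using l by (auto intro!: first sq)
  qed
qed (auto simp: pairings_def intro!: paired_line_is_triple)

lemma inj_on_paired_line:
  "inj_on (\<lambda>((i, j, k, m), \<alpha>, \<beta>). paired_line i j \<alpha> k m \<beta>)
     (pairings \<times> {\<alpha>. \<alpha> ^ 3 = 1} \<times> {\<beta>. \<beta> ^ 3 = 1})"
proof -
  have "(i, j, k, m, \<alpha>, \<beta>) = (i', j', k', m', \<alpha>', \<beta>')"
    if eq: "paired_line i j \<alpha> k m \<beta> = paired_line i' j' \<alpha>' k' m' \<beta>'"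
      and q: "(i, j, k, m) \<in> pairings" "(i', j', k', m') \<in> pairings"
      and cubes: "\<alpha> ^ 3 = 1" "\<beta> ^ 3 = 1" "\<alpha>' ^ 3 = 1" "\<beta>' ^ 3 = 1"
    for i j k m \<alpha> \<beta> i' j' k' m' \<alpha>' \<beta>'
  proof -
    have nz: "\<alpha> \<noteq> 0" "\<beta> \<noteq> 0" "\<alpha>' \<noteq> 0" "\<beta>' \<noteq> 0"
      using cubes by auto
    have "pair_vec i j \<alpha> \<in> paired_line i j \<alpha> k m \<beta>" "pair_vec k m \<beta> \<in> paired_line i j \<alpha> k m \<beta>"
      using q(1) by (auto simp: pairings_def paired_line_eq_span vec.span_base)
    then have "(i, j, \<alpha>) = (i', j', \<alpha>') \<or> (i, j, \<alpha>) = (k', m', \<beta>')"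
      "(k, m, \<beta>) = (i', j', \<alpha>') \<or> (k, m, \<beta>) = (k', m', \<beta>')"
      using q nz unfolding eq by (auto simp: pairings_def dest!: pair_vec_mem_paired_line[rotated -1])
    then show ?thesis
      using q by (auto simp: pairings_def)
  qed
  then show ?thesis
    by (auto simp: inj_on_def)
qed

theorem proposition1p2:
  "card {l. triple_line fermat_cubic l} = 135"
  unfolding triple_lines_eq card_image[OF inj_on_paired_line]
  by (simp add: card_cartesian_product card_pairings card_roots_unity_eq)

end
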